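(* Let $\mathcal G$ be a polynomial jump-diffusion operator with coefficients $b(x)=b_0+b_1x$, $\sigma^2(x)=\sigma_0+\sigma_1x+\sigma_2x^2$ and $\int_{\mathbb R}z^m\ell(x,dz)=\sum_{i=0}^m\xi_i^mx^i$ for every $m\ge2$, with real constants $b_i,\sigma_i,\xi_i^m$. Let $c_1:=b_1$ and $c_j:=jb_1+\tfrac12j(j-1)\sigma_2+\sum_{k=2}^j\binom jk\xi_k^k$ for $j\ge2$. Fix $n\ge2$ and suppose that $$c_j\ne0\ \text{ for every }2\le j\le n,\qquad c_j\ne c_i\ \text{ for every }1\le j<i\le n.$$ Let $\Lambda_n:=c_nI_n-G_{n-1}$. Then for every $t\ge0$ $$e^{G_nt}=\begin{pmatrix}e^{G_{n-1}t}&\vec0_n\\ \vec a_n^{\top}\Lambda_n^{-1}\left(e^{c_nt}I_n-e^{G_{n-1}t}\right)&e^{c_nt}\end{pmatrix},$$ with $$e^{G_1t}=\begin{pmatrix}1&0\\ \frac{b_0}{b_1}(e^{b_1t}-1)&e^{b_1t}\end{pmatrix}\text{ if }b_1\ne0,\qquad e^{G_1t}=\begin{pmatrix}1&0\\ b_0t&1\end{pmatrix}\text{ if }b_1=0.$$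
   Context: The jump-diffusion operator is $$\mathcal G f(x)=b(x)f'(x)+\tfrac12\sigma^2(x)f''(x)+\int_{\mathbb R}\left(f(x+z)-f(x)-f'(x)z\right)\ell(x,dz),$$ with $b,\sigma:\mathbb R\to\mathbb R$ measurable and $\ell$ a transition kernel with $\ell(x,\{0\})=0$, $\int_{\mathbb R}|z|\wedge|z|^2\ell(x,dz)<\infty$ and $\int_{\mathbb R}|z|^n\ell(x,dz)<\infty$ for all $x\in\mathbb R$, $n\ge2$. With $H_n(x)=(1,x,\dots,x^n)^{\top}$, the generator matrix $G_n\in\mathbb R^{(n+1)\times(n+1)}$ is defined by $\mathcal GH_n(x)=G_nH_n(x)$ (componentwise action). It satisfies $G_1=\begin{pmatrix}0&0\\ b_0&b_1\end{pmatrix}$ and, for $n\ge2$, $G_n=\begin{pmatrix}G_{n-1}&\vec0_n\\ \vec a_n^{\top}&c_n\end{pmatrix}$, where $\vec0_n$ is the $n$-dimensional zero vector, $\vec a_n=(a_n^n,a_n^{n-1},\dots,a_n^1)^{\top}\in\mathbb R^n$, $a_n^1=nb_0+\tfrac12n(n-1)\sigma_1+\sum_{k=2}^n\binom nk\xi_{k-1}^k$, $a_n^2=\tfrac12n(n-1)\sigma_0+\sum_{k=2}^n\binom nk\xi_{k-2}^k$, and $a_n^i=\sum_{k=i}^n\binom nk\xi_{k-i}^k$ for $3\le i\le n$. $I_n$ is the $n\times n$ identity. Upper symbols in $\xi_i^m$, $a_n^i$ are indices, not powers. *)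

theory Defs
  imports "HOL-Analysis.Analysis" "Jordan_Normal_Form.Gauss_Jordan_Elimination"
begin

section \<open>Jump-diffusion operators\<close>

text \<open>The measures \<open>ell x\<close> may be infinite (as for Levy measures), so a transition kernel is
  a family of Borel measures on the real line, measurable in the first argument, with no
  finiteness requirement built in.\<close>

definition transition_kernel :: "(real \<Rightarrow> real measure) \<Rightarrow> bool" where
  "transition_kernel ell \<longleftrightarrow>
     (\<forall>x. sets (ell x) = sets borel) \<and>
     (\<forall>B\<in>sets borel. (\<lambda>x. emeasure (ell x) B) \<in> borel_measurable borel)"

definition jump_diffusion ::
  "(real \<Rightarrow> real) \<Rightarrow> (real \<Rightarrow> real) \<Rightarrow> (real \<Rightarrow> real measure) \<Rightarrow> bool" where
  "jump_diffusion b \<sigma> ell \<longleftrightarrow>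
     b \<in> borel_measurable borel \<and> \<sigma> \<in> borel_measurable borel \<and> transition_kernel ell \<and>
     (\<forall>x. emeasure (ell x) {0} = 0) \<and>
     (\<forall>x. (\<integral>\<^sup>+ z. ennreal (min \<bar>z\<bar> (\<bar>z\<bar>\<^sup>2)) \<partial>ell x) < \<infinity>) \<and>
     (\<forall>x. \<forall>n\<ge>2. (\<integral>\<^sup>+ z. ennreal (\<bar>z\<bar> ^ n) \<partial>ell x) < \<infinity>)"

definition jd_operator ::
  "(real \<Rightarrow> real) \<Rightarrow> (real \<Rightarrow> real) \<Rightarrow> (real \<Rightarrow> real measure) \<Rightarrow> (real \<Rightarrow> real) \<Rightarrow> real \<Rightarrow> real" where
  "jd_operator b \<sigma> ell f x =
     b x * deriv f x + 1 / 2 * (\<sigma> x)\<^sup>2 * deriv (deriv f) x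
     + (\<integral>z. (f (x + z) - f x - deriv f x * z) \<partial>ell x)"

section \<open>Generator matrices\<close>

definition monomial_vec :: "nat \<Rightarrow> real \<Rightarrow> real vec" where
  "monomial_vec n x = vec (n + 1) (\<lambda>i. x ^ i)"

text \<open>The \<open>(n+1) \<times> (n+1)\<close> matrix \<open>G\<close> with \<open>\<G> H\<^sub>n(x) = G H\<^sub>n(x)\<close> for all \<open>x\<close>, where
  \<open>\<G>\<close> acts componentwise on \<open>H\<^sub>n\<close>. It is unique because the monomials are linearly
  independent; it exists whenever \<open>\<G>\<close> does not increase the degree of polynomials.\<close>

definition generator_matrix :: "((real \<Rightarrow> real) \<Rightarrow> real \<Rightarrow> real) \<Rightarrow> nat \<Rightarrow> real mat" where
  "generator_matrix \<G> n = (THE G. G \<in> carrier_mat (n + 1) (n + 1) \<and>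
     (\<forall>x. vec (n + 1) (\<lambda>i. \<G> (\<lambda>y. vec_index (monomial_vec n y) i) x) = G *\<^sub>v monomial_vec n x))"

text \<open>Here and below \<open>\<xi> m i\<close> stands for \<open>\<xi>\<^sub>i\<^sup>m\<close>, the coefficient of \<open>x\<^sup>i\<close> in the
  \<open>m\<close>-th moment of \<open>ell(x, dz)\<close>.\<close>

definition gen_c :: "real \<Rightarrow> real \<Rightarrow> (nat \<Rightarrow> nat \<Rightarrow> real) \<Rightarrow> nat \<Rightarrow> real" where
  "gen_c b1 \<sigma>2 \<xi> j =
     (if j = 1 then b1
      else real j * b1 + 1 / 2 * real j * (real j - 1) * \<sigma>2
           + (\<Sum>k=2..j. real (j choose k) * \<xi> k k))"

text \<open>\<open>gen_a b0 \<sigma>0 \<sigma>1 \<xi> n i\<close> is \<open>a\<^sub>n\<^sup>i\<close>, for \<open>1 \<le> i \<le> n\<close>.\<close>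

definition gen_a ::
  "real \<Rightarrow> real \<Rightarrow> real \<Rightarrow> (nat \<Rightarrow> nat \<Rightarrow> real) \<Rightarrow> nat \<Rightarrow> nat \<Rightarrow> real" where
  "gen_a b0 \<sigma>0 \<sigma>1 \<xi> n i =
     (if i = 1 then real n * b0 + 1 / 2 * real n * (real n - 1) * \<sigma>1
                    + (\<Sum>k=2..n. real (n choose k) * \<xi> k (k - 1))
      else if i = 2 then 1 / 2 * real n * (real n - 1) * \<sigma>0
                    + (\<Sum>k=2..n. real (n choose k) * \<xi> k (k - 2))
      else (\<Sum>k=i..n. real (n choose k) * \<xi> k (k - i)))"

text \<open>Decreasing upper index: entry \<open>j\<close> (counted from \<open>0\<close>) is \<open>a\<^sub>n\<^bsup>n-j\<^esup>\<close>.\<close>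

definition gen_a_vec ::
  "real \<Rightarrow> real \<Rightarrow> real \<Rightarrow> (nat \<Rightarrow> nat \<Rightarrow> real) \<Rightarrow> nat \<Rightarrow> real vec" where
  "gen_a_vec b0 \<sigma>0 \<sigma>1 \<xi> n = vec n (\<lambda>j. gen_a b0 \<sigma>0 \<sigma>1 \<xi> n (n - j))"

section \<open>Matrix exponential and inverse\<close>

text \<open>The exponential series, taken entrywise; it converges for every square matrix.\<close>

definition mat_exp :: "real mat \<Rightarrow> real mat" where
  "mat_exp A = mat (dim_row A) (dim_col A) (\<lambda>(i, j). \<Sum>k. (A ^\<^sub>m k) $$ (i, j) / fact k)"

text \<open>Only meaningful for invertible \<open>A\<close>, where \<^const>\<open>mat_inverse\<close> does not return
  \<^const>\<open>None\<close>.\<close>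

definition mat_inv :: "real mat \<Rightarrow> real mat" where
  "mat_inv A = the (mat_inverse A)"

end

theory Submission
  imports Defs "Jordan_Normal_Form.Determinant"
begin

text \<open>Applying \<open>\<G>\<close> to \<open>x\<^sup>i\<close> and expanding \<open>(x + z)\<^sup>i\<close> binomially gives the rows of the
  generator matrices, so \<open>G\<^sub>n\<close> is block lower triangular with blocks \<open>B = G\<^bsub>n-1\<^esub>\<close>, \<open>a\<close> and \<open>c\<close>. As \<open>\<Lambda> = c I - B\<close>
  is triangular with diagonal entries \<open>c\<^sub>n - c\<^sub>j \<noteq> 0\<close>, there is a row \<open>q = a \<Lambda>\<^sup>-\<^sup>1\<close> with
  \<open>a = q (c I - B)\<close>. The lower left block of the \<open>k\<close>-th power then telescopes to
  \<open>q (c\<^sup>k I - B\<^sup>k)\<close>, and summing the exponential series entrywise gives the formula.\<close>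

section \<open>Matrix inverses and entrywise convergence of the exponential series\<close>

lemma det_nonzero_mat_inv:
  assumes "A \<in> carrier_mat n n" and "det A \<noteq> 0"
  shows "invertible_mat A" and "mat_inv A \<in> carrier_mat n n"
    and "A * mat_inv A = 1\<^sub>m n" and "mat_inv A * A = 1\<^sub>m n"
proof -
  have "A \<in> Units (ring_mat TYPE(real) n undefined)"
    using det_non_zero_imp_unit[OF assms] .
  \<comment> \<open>\<open>mat_inverse\<close> returns \<open>None\<close> only on non-units, so the
    nonzero determinant makes the \<open>the\<close> in \<open>mat_inv\<close> well defined.\<close>
  then obtain B where B: "mat_inverse A = Some B"
    using mat_inverse(1)[OF assms(1)] by fastforce
  note AB = mat_inverse(2)[OF assms(1) B]
  have "mat_inv A = B"
    by (simp add: mat_inv_def B)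
  with AB show "mat_inv A \<in> carrier_mat n n" "A * mat_inv A = 1\<^sub>m n" "mat_inv A * A = 1\<^sub>m n"
    by auto
  show "invertible_mat A"
    unfolding invertible_mat_def inverts_mat_def using AB assms(1) by (auto intro!: exI[of _ B])
qed

text \<open>Each further factor \<open>A\<close> turns an entry into a sum of \<open>n\<close> terms
  and enlarges each term by at most \<open>K\<close>, so the bound gains \<open>n * K\<close> per
  step.\<close>

lemma pow_mat_entry_bound:
  fixes A :: "real mat"
  assumes A: "A \<in> carrier_mat n n" and K: "\<And>i j. i < n \<Longrightarrow> j < n \<Longrightarrow> \<bar>A $$ (i, j)\<bar> \<le> K"
    and "i < n" "j < n"
  shows "\<bar>(A ^\<^sub>m k) $$ (i, j)\<bar> \<le> (real n * K) ^ k"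
  using \<open>j < n\<close>
proof (induction k arbitrary: j)
  case 0
  then show ?case using \<open>i < n\<close> A by simp
next
  case (Suc k)
  have "(A ^\<^sub>m Suc k) $$ (i, j) = (\<Sum>l = 0..<n. (A ^\<^sub>m k) $$ (i, l) * A $$ (l, j))"
    using A \<open>i < n\<close> Suc.prems by (simp add: scalar_prod_def)
  also have "\<bar>\<dots>\<bar> \<le> (\<Sum>l = 0..<n. \<bar>(A ^\<^sub>m k) $$ (i, l)\<bar> * \<bar>A $$ (l, j)\<bar>)"
    by (rule order.trans[OF sum_abs]) (simp add: abs_mult)
  \<comment> \<open>The nonnegativity of the bound that \<open>mult_mono\<close> asks for holds
    because, by induction, it dominates an absolute value.\<close>
  also have "\<dots> \<le> (\<Sum>l = 0..<n. (real n * K) ^ k * K)"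
    using Suc K by (intro sum_mono mult_mono) (auto intro: order_trans[OF abs_ge_zero])
  finally show ?case by (simp add: mult_ac)
qed

text \<open>With \<open>K\<close> the largest absolute entry, the scalar series of exp(n K) is a
  majorant.\<close>

lemma summable_pow_mat_entry:
  fixes A :: "real mat"
  assumes A: "A \<in> carrier_mat n n" and "i < n" "j < n"
  shows "summable (\<lambda>k. (A ^\<^sub>m k) $$ (i, j) / fact k)"
proof -
  define K where "K = Max ((\<lambda>p. \<bar>A $$ p\<bar>) ` ({..<n} \<times> {..<n}))"
  have K: "\<bar>A $$ (i, j)\<bar> \<le> K" if "i < n" "j < n" for i j
    unfolding K_def using that by (intro Max_ge) auto
  show ?thesis
  proof (rule summable_comparison_test'[where N = 0])
    show "summable (\<lambda>k. (real n * K) ^ k / fact k)"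
      using summable_exp_generic[of "real n * K"] by (simp add: divide_inverse mult.commute)
    show "norm ((A ^\<^sub>m k) $$ (i, j) / fact k) \<le> (real n * K) ^ k / fact k" for k
      using pow_mat_entry_bound[OF A K \<open>i < n\<close> \<open>j < n\<close>, of k]
      by (simp add: divide_right_mono)
  qed
qed

lemma mat_exp_sums:
  assumes "A \<in> carrier_mat n n" and "i < n" "j < n"
  shows "(\<lambda>k. (A ^\<^sub>m k) $$ (i, j) / fact k) sums mat_exp A $$ (i, j)"
  using summable_sums[OF summable_pow_mat_entry[OF assms]] assms by (simp add: mat_exp_def)

lemma exp_sums_real: "(\<lambda>k. x ^ k / fact k) sums exp (x :: real)"
  using exp_converges[of x] by (simp add: divide_inverse mult.commute)

text \<open>Limits of series are unique, so an explicit exponential only needs a closed form of the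
  powers and a sum for each entry. All exponentials below are found in this way.\<close>

lemma mat_exp_eqI:
  assumes A: "A \<in> carrier_mat n n" and E: "E \<in> carrier_mat n n"
    and "\<And>i j. i < n \<Longrightarrow> j < n \<Longrightarrow> (\<lambda>k. (A ^\<^sub>m k) $$ (i, j) / fact k) sums E $$ (i, j)"
  shows "mat_exp A = E"
proof (rule eq_matI)
  fix i j
  assume "i < dim_row E" "j < dim_col E"
  with E have "i < n" "j < n" by auto
  with mat_exp_sums[OF A this] assms(3)[OF this] show "mat_exp A $$ (i, j) = E $$ (i, j)"
    by (blast dest: sums_unique2)
qed (use A E in \<open>auto simp: mat_exp_def\<close>)

lemma mat_exp_carrier [simp]: "A \<in> carrier_mat n n \<Longrightarrow> mat_exp A \<in> carrier_mat n n"
  by (auto simp: mat_exp_def)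

section \<open>Powers and exponential of a block lower triangular matrix\<close>

lemma pow_four_block_lower:
  fixes B :: "real mat"
  assumes B: "B \<in> carrier_mat n n" and q: "q \<in> carrier_mat 1 n"
    and r: "r = q * (x \<cdot>\<^sub>m 1\<^sub>m n - B)"
  shows "four_block_mat B (0\<^sub>m n 1) r (x \<cdot>\<^sub>m 1\<^sub>m 1) ^\<^sub>m k =
    four_block_mat (B ^\<^sub>m k) (0\<^sub>m n 1) (q * (x ^ k \<cdot>\<^sub>m 1\<^sub>m n - B ^\<^sub>m k)) (x ^ k \<cdot>\<^sub>m 1\<^sub>m 1)"
proof (induction k)
  case 0
  \<comment> \<open>At exponent 0 the lower left block is \<open>q\<close> times I - I, hence zero,
    as in the identity matrix.\<close>
  have "1 \<cdot>\<^sub>m 1\<^sub>m n - 1\<^sub>m n = (0\<^sub>m n n :: real mat)" "1 \<cdot>\<^sub>m 1\<^sub>m 1 = (1\<^sub>m 1 :: real mat)"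
    by (auto intro!: eq_matI)
  with B q show ?case by simp
next
  case (Suc k)
  let ?P = "B ^\<^sub>m k" and ?D = "x ^ k \<cdot>\<^sub>m 1\<^sub>m n - B ^\<^sub>m k"
  have P: "?P \<in> carrier_mat n n" and D: "?D \<in> carrier_mat n n"
    using B by auto
  have r': "r \<in> carrier_mat 1 n"
    using r q B by auto
  have DB: "?D * B = x ^ k \<cdot>\<^sub>m B - ?P * B"
    using B P by (simp add: minus_mult_distrib_mat[of _ n n _ _ n] mult_smult_assoc_mat[of _ n n _ n])
  have "q * ?D * B + x ^ k \<cdot>\<^sub>m 1\<^sub>m 1 * r = q * (?D * B) + x ^ k \<cdot>\<^sub>m (q * (x \<cdot>\<^sub>m 1\<^sub>m n - B))"
    using q B D r'
    by (simp add: assoc_mult_mat[of _ 1 n _ n _ n] mult_smult_assoc_mat[of _ 1 1 _ n] r[symmetric]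
        flip: One_nat_def)
  also have "\<dots> = q * (?D * B) + q * (x ^ k \<cdot>\<^sub>m (x \<cdot>\<^sub>m 1\<^sub>m n - B))"
    using q B by (subst mult_smult_distrib[of _ 1 n _ n]) auto
  also have "\<dots> = q * (?D * B + x ^ k \<cdot>\<^sub>m (x \<cdot>\<^sub>m 1\<^sub>m n - B))"
    using q B D by (subst mult_add_distrib_mat[of _ 1 n _ n]) auto
  \<comment> \<open>The telescoping: the two terms x^k B cancel between (x^k I - B^k) B and x^k (x I
    - B).\<close>
  also have "?D * B + x ^ k \<cdot>\<^sub>m (x \<cdot>\<^sub>m 1\<^sub>m n - B) = x ^ Suc k \<cdot>\<^sub>m 1\<^sub>m n - ?P * B"
    unfolding DB using B P by (intro eq_matI) (auto simp: algebra_simps)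
  finally have row: "q * ?D * B + x ^ k \<cdot>\<^sub>m 1\<^sub>m 1 * r = q * (x ^ Suc k \<cdot>\<^sub>m 1\<^sub>m n - B ^\<^sub>m Suc k)"
    by simp
  have corner: "x ^ k \<cdot>\<^sub>m 1\<^sub>m 1 * (x \<cdot>\<^sub>m 1\<^sub>m 1) = (x ^ Suc k \<cdot>\<^sub>m 1\<^sub>m 1 :: real mat)"
    by (intro eq_matI) (auto simp: scalar_prod_def)
  show ?case
    unfolding pow_mat.simps(2) Suc.IH
    by (subst mult_four_block_mat[of _ n n _ 1 _ 1 _ _ n _ 1])
      (use B q r' P D row corner in \<open>auto\<close>)
qed

text \<open>As \<open>q\<close> does not depend on \<open>k\<close>, each entry of the lower left
  block is a fixed finite combination of scalar exponential series and entry series of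
  \<open>mat_exp B\<close>, so the sum passes through the product with \<open>q\<close>.\<close>

lemma mat_exp_four_block_lower:
  fixes B :: "real mat"
  assumes B: "B \<in> carrier_mat n n" and q: "q \<in> carrier_mat 1 n"
    and r: "r = q * (x \<cdot>\<^sub>m 1\<^sub>m n - B)"
  shows "mat_exp (four_block_mat B (0\<^sub>m n 1) r (x \<cdot>\<^sub>m 1\<^sub>m 1)) =
    four_block_mat (mat_exp B) (0\<^sub>m n 1) (q * (exp x \<cdot>\<^sub>m 1\<^sub>m n - mat_exp B)) (exp x \<cdot>\<^sub>m 1\<^sub>m 1)"
    (is "mat_exp ?A = ?E")
proof (rule mat_exp_eqI[where n = "n + 1"])
  show "?A \<in> carrier_mat (n + 1) (n + 1)" "?E \<in> carrier_mat (n + 1) (n + 1)"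
    by (intro four_block_carrier_mat B mat_exp_carrier[OF B]; simp)+
  fix i j
  assume ij: "i < n + 1" "j < n + 1"
  have dims: "dim_row B = n" "dim_col B = n" "dim_row q = 1" "dim_col q = n"
    "dim_row (mat_exp B) = n" "dim_col (mat_exp B) = n"
    using B q by (auto simp: mat_exp_def)
  have row: "(\<lambda>k. (q * (x ^ k \<cdot>\<^sub>m 1\<^sub>m n - B ^\<^sub>m k)) $$ (0, j) / fact k)
    sums (q * (exp x \<cdot>\<^sub>m 1\<^sub>m n - mat_exp B)) $$ (0, j)" if j: "j < n"
  proof -
    have "(\<lambda>k. q $$ (0, l) * (x ^ k / fact k * 1\<^sub>m n $$ (l, j) - (B ^\<^sub>m k) $$ (l, j) / fact k))
      sums (q $$ (0, l) * (exp x * 1\<^sub>m n $$ (l, j) - mat_exp B $$ (l, j)))" if "l < n" for l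
      by (intro sums_mult sums_diff sums_mult2 exp_sums_real mat_exp_sums[OF B that j])
    then have "(\<lambda>k. \<Sum>l = 0..<n. q $$ (0, l) *
        (x ^ k / fact k * 1\<^sub>m n $$ (l, j) - (B ^\<^sub>m k) $$ (l, j) / fact k))
      sums (\<Sum>l = 0..<n. q $$ (0, l) * (exp x * 1\<^sub>m n $$ (l, j) - mat_exp B $$ (l, j)))"
      by (intro sums_sum) auto
    moreover have "(q * (x ^ k \<cdot>\<^sub>m 1\<^sub>m n - B ^\<^sub>m k)) $$ (0, j) / fact k = (\<Sum>l = 0..<n. q $$ (0, l) *
        (x ^ k / fact k * 1\<^sub>m n $$ (l, j) - (B ^\<^sub>m k) $$ (l, j) / fact k))" for k
    proof -
      have "(q * (x ^ k \<cdot>\<^sub>m 1\<^sub>m n - B ^\<^sub>m k)) $$ (0, j) =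
        (\<Sum>l = 0..<n. q $$ (0, l) * (x ^ k * 1\<^sub>m n $$ (l, j) - (B ^\<^sub>m k) $$ (l, j)))"
        using j B dims by (simp add: scalar_prod_def)
      then show ?thesis
        by (simp add: sum_divide_distrib diff_divide_distrib right_diff_distrib)
    qed
    moreover have "(q * (exp x \<cdot>\<^sub>m 1\<^sub>m n - mat_exp B)) $$ (0, j) =
      (\<Sum>l = 0..<n. q $$ (0, l) * (exp x * 1\<^sub>m n $$ (l, j) - mat_exp B $$ (l, j)))"
      using j dims by (simp add: scalar_prod_def)
    ultimately show ?thesis by simp
  qed
  consider "i < n" "j < n" | "i < n" "j = n" | "i = n" "j < n" | "i = n" "j = n"
    using ij by linarith
  then show "(\<lambda>k. (?A ^\<^sub>m k) $$ (i, j) / fact k) sums ?E $$ (i, j)"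
  proof cases
    case 1
    then show ?thesis
      unfolding pow_four_block_lower[OF B q r] using mat_exp_sums[OF B 1] B by (simp add: dims cong: if_cong)
  next
    case 2
    then show ?thesis
      unfolding pow_four_block_lower[OF B q r] using B by (simp add: dims cong: if_cong)
  next
    case 3
    then show ?thesis
      unfolding pow_four_block_lower[OF B q r] using row B by (simp add: dims cong: if_cong)
  next
    case 4
    then show ?thesis
      unfolding pow_four_block_lower[OF B q r] using exp_sums_real[of x] B by (simp add: dims cong: if_cong)
  qed
qed

section \<open>Explicit exponentials of the 2 by 2 matrices\<close>

lemma index_mat_2x2:
  "mat_of_rows_list 2 [[a, b], [c, d]] $$ (0, 0) = a"
  "mat_of_rows_list 2 [[a, b], [c, d]] $$ (0, Suc 0) = b"
  "mat_of_rows_list 2 [[a, b], [c, d]] $$ (Suc 0, 0) = c"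
  "mat_of_rows_list 2 [[a, b], [c, d]] $$ (Suc 0, Suc 0) = d"
  by (simp_all add: mat_of_rows_list_def)

text \<open>The lower left entry is \<open>p\<close> times the divided difference of y^k at the
  eigenvalues 0 and \<open>x\<close>. Since \<open>0 ^ 0 = 1\<close>, writing \<open>0 ^ k\<close>
  covers the exponent 0 uniformly.\<close>

lemma pow_mat_2x2_lower:
  fixes p x :: real
  assumes "x \<noteq> 0"
  shows "mat_of_rows_list 2 [[0, 0], [p, x]] ^\<^sub>m k =
    mat_of_rows_list 2 [[0 ^ k, 0], [p / x * (x ^ k - 0 ^ k), x ^ k]]"
  using assms
  by (induction k)
    (auto intro!: eq_matI simp: mat_of_rows_list_def scalar_prod_def less_2_cases_iff field_simps
      numeral_2_eq_2 less_Suc_eq)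

text \<open>The confluent case: the divided difference becomes the derivative of y^k at 0, which is
  nonzero only for \<open>k = 1\<close>.\<close>

lemma pow_mat_2x2_nilpotent:
  fixes p :: real
  shows "mat_of_rows_list 2 [[0, 0], [p, 0]] ^\<^sub>m k =
    mat_of_rows_list 2 [[0 ^ k, 0], [if k = 1 then p else 0, 0 ^ k]]"
  by (induction k)
    (auto intro!: eq_matI simp: mat_of_rows_list_def scalar_prod_def
      numeral_2_eq_2 less_Suc_eq)

lemma mat_exp_2x2_lower:
  fixes p x :: real
  assumes "x \<noteq> 0"
  shows "mat_exp (mat_of_rows_list 2 [[0, 0], [p, x]]) =
    mat_of_rows_list 2 [[1, 0], [p / x * (exp x - 1), exp x]]"
proof (rule mat_exp_eqI[where n = 2])
  fix i j :: nat
  assume "i < 2" "j < 2"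
  \<comment> \<open>The \<open>0 ^ k\<close> terms form the exponential series at 0, whose sum
    \<open>exp 0\<close> is the 1 subtracted in the entry.\<close>
  moreover have "(\<lambda>k. p / x * (x ^ k - 0 ^ k) / fact k) sums (p / x * (exp x - exp 0))"
    using sums_mult[OF sums_diff[OF exp_sums_real[of x] exp_sums_real[of 0]], of "p / x"]
    by (simp add: diff_divide_distrib[symmetric] mult.commute)
  ultimately show "(\<lambda>k. (mat_of_rows_list 2 [[0, 0], [p, x]] ^\<^sub>m k) $$ (i, j) / fact k)
      sums mat_of_rows_list 2 [[1, 0], [p / x * (exp x - 1), exp x]] $$ (i, j)"
    using exp_sums_real[of x] exp_sums_real[of 0]
    by (auto simp: pow_mat_2x2_lower[OF assms] less_2_cases_iff index_mat_2x2)
qed (auto simp: mat_of_rows_list_def)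

lemma mat_exp_2x2_nilpotent:
  fixes p :: real
  shows "mat_exp (mat_of_rows_list 2 [[0, 0], [p, 0]]) = mat_of_rows_list 2 [[1, 0], [p, 1]]"
proof (rule mat_exp_eqI[where n = 2])
  fix i j :: nat
  assume "i < 2" "j < 2"
  moreover have "(\<lambda>k. (if k = 1 then p else 0) / fact k) sums p"
    using sums_single[of 1 "\<lambda>k. p / fact k"] by (simp add: if_distrib[of "\<lambda>y. y / _"] cong: if_cong)
  ultimately show "(\<lambda>k. (mat_of_rows_list 2 [[0, 0], [p, 0]] ^\<^sub>m k) $$ (i, j) / fact k)
      sums mat_of_rows_list 2 [[1, 0], [p, 1]] $$ (i, j)"
    using exp_sums_real[of 0]
    by (auto simp: pow_mat_2x2_nilpotent less_2_cases_iff index_mat_2x2)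
qed (auto simp: mat_of_rows_list_def)


section \<open>Explicit entries of the generator matrices\<close>

definition gen_entry ::
  "real \<Rightarrow> real \<Rightarrow> real \<Rightarrow> real \<Rightarrow> real \<Rightarrow> (nat \<Rightarrow> nat \<Rightarrow> real) \<Rightarrow> nat \<Rightarrow> nat \<Rightarrow> real" where
  "gen_entry b0 b1 \<sigma>0 \<sigma>1 \<sigma>2 \<xi> i j =
     (if j = i then gen_c b1 \<sigma>2 \<xi> i
      else if j < i then gen_a b0 \<sigma>0 \<sigma>1 \<xi> i (i - j)
      else 0)"

text \<open>Row \<open>i\<close> lists the coefficients of \<G> applied to x^i, with rows and
  columns counted from 0. Column \<open>j\<close> thus takes the upper index \<open>i - j\<close>,
  and the zeros above the diagonal say that degrees do not increase.\<close>

definition gen_mat ::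
  "real \<Rightarrow> real \<Rightarrow> real \<Rightarrow> real \<Rightarrow> real \<Rightarrow> (nat \<Rightarrow> nat \<Rightarrow> real) \<Rightarrow> nat \<Rightarrow> real mat" where
  "gen_mat b0 b1 \<sigma>0 \<sigma>1 \<sigma>2 \<xi> n =
     mat (n + 1) (n + 1) (\<lambda>(i, j). gen_entry b0 b1 \<sigma>0 \<sigma>1 \<sigma>2 \<xi> i j)"

lemma gen_mat_carrier [simp]: "gen_mat b0 b1 \<sigma>0 \<sigma>1 \<sigma>2 \<xi> n \<in> carrier_mat (n + 1) (n + 1)"
  by (simp add: gen_mat_def)

text \<open>Matches the fact that \<G> annihilates constants; hence \<open>gen_c\<close> gives the
  whole diagonal, including its first entry.\<close>

lemma gen_c_0 [simp]: "gen_c b1 \<sigma>2 \<xi> 0 = 0"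
  by (simp add: gen_c_def)

text \<open>Indexing by the drop in degree \<open>r\<close> separates drift (r = 0, 1), diffusion (r
  = 0, 1, 2) and jumps (all \<open>r\<close>). The bound \<open>max 2 r\<close> unifies the case
  distinctions, because the jump moments start at order 2.\<close>

lemma gen_entry_decomp:
  assumes "r \<le> m"
  shows "gen_entry b0 b1 \<sigma>0 \<sigma>1 \<sigma>2 \<xi> m (m - r) =
    (if r = 0 then real m * b1 + 1 / 2 * real m * (real m - 1) * \<sigma>2 else 0)
    + (if r = 1 then real m * b0 + 1 / 2 * real m * (real m - 1) * \<sigma>1 else 0)
    + (if r = 2 then 1 / 2 * real m * (real m - 1) * \<sigma>0 else 0)
    + (\<Sum>k = max 2 r..m. real (m choose k) * \<xi> k (k - r))"
proof -
  have below: "gen_entry b0 b1 \<sigma>0 \<sigma>1 \<sigma>2 \<xi> m (m - r) = gen_a b0 \<sigma>0 \<sigma>1 \<xi> m r"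
    if "r \<noteq> 0"
  proof -
    have "m - r \<noteq> m" "m - r < m" "m - (m - r) = r"
      using assms that by auto
    then show ?thesis by (simp add: gen_entry_def)
  qed
  show ?thesis
  proof (cases "r = 0")
    case True
    then show ?thesis by (simp add: gen_entry_def gen_c_def)
  next
    case False
    then show ?thesis unfolding below[OF False] by (simp add: gen_a_def max_def)
  qed
qed

section \<open>Action of the operator on monomials\<close>

lemma integrable_power:
  assumes M: "sets M = sets borel" and "(\<integral>\<^sup>+ z. ennreal (\<bar>z\<bar> ^ k) \<partial>M) < \<infinity>"
  shows "integrable M (\<lambda>z :: real. z ^ k)"
proof (rule integrableI_bounded)
  have "(\<lambda>z :: real. z ^ k) \<in> borel_measurable borel"
    by measurable
  then show "(\<lambda>z :: real. z ^ k) \<in> borel_measurable M"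
    unfolding measurable_cong_sets[OF M refl] .
qed (use assms in \<open>simp add: power_abs\<close>)

text \<open>The compensation in the jump integrand removes exactly the terms k = 0 and k = 1 of the
  binomial expansion, leaving only powers of \<open>z\<close> with finite moments.\<close>

lemma binomial_remainder:
  fixes x z :: real
  shows "(x + z) ^ m - x ^ m - real m * x ^ (m - 1) * z =
    (\<Sum>k = 2..m. real (m choose k) * x ^ (m - k) * z ^ k)"
proof -
  have "(x + z) ^ m = (\<Sum>k\<le>m. real (m choose k) * x ^ (m - k) * z ^ k)"
    by (subst add.commute, subst binomial_ring) (simp add: mult_ac)
  moreover have "(\<Sum>k\<le>m. real (m choose k) * x ^ (m - k) * z ^ k) =
    x ^ m + real m * x ^ (m - 1) * z + (\<Sum>k = 2..m. real (m choose k) * x ^ (m - k) * z ^ k)"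
  proof (cases "2 \<le> m")
    case True
    then have "{..m} = insert 0 (insert 1 {2..m})"
      by auto
    then show ?thesis by simp
  next
    case False
    then have "m = 0 \<or> m = 1"
      by linarith
    then show ?thesis by auto
  qed
  ultimately show ?thesis by simp
qed

lemma deriv_monomial: "deriv (\<lambda>y :: real. y ^ m) = (\<lambda>y. real m * y ^ (m - 1))"
  by (intro ext DERIV_imp_deriv) (auto intro!: derivative_eq_intros)

lemma deriv_deriv_monomial:
  "deriv (deriv (\<lambda>y :: real. y ^ m)) = (\<lambda>y. real m * (real m - 1) * y ^ (m - 2))"
proof
  fix x :: real
  have "((\<lambda>y. real m * y ^ (m - 1)) has_real_derivative
      real m * (real (m - 1) * x ^ (m - 1 - 1))) (at x)"
    by (intro DERIV_cmult) (auto intro!: derivative_eq_intros)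
  \<comment> \<open>For \<open>m < 2\<close> the truncated exponents do no harm, since the
    coefficient m (m - 1) vanishes.\<close>
  also have "real m * (real (m - 1) * x ^ (m - 1 - 1)) = real m * (real m - 1) * x ^ (m - 2)"
    by (cases m) (auto simp: numeral_2_eq_2)
  finally show "deriv (deriv (\<lambda>y. y ^ m)) x = real m * (real m - 1) * x ^ (m - 2)"
    unfolding deriv_monomial by (rule DERIV_imp_deriv)
qed

text \<open>In the \<open>k\<close>-th term x^(m-k) multiplies a moment of degree at most
  \<open>k\<close>, and the coefficient \<open>\<xi> k (k - r)\<close> lands on x^(m-r) whatever
  \<open>k\<close> is. Collecting by \<open>r\<close> is therefore an exchange of two sums.\<close>

lemma jump_part_monomial:
  assumes "jump_diffusion b \<sigma> ell"
    and moments: "\<And>m x. 2 \<le> m \<Longrightarrow> (\<integral>z. z ^ m \<partial>ell x) = (\<Sum>i=0..m. \<xi> m i * x ^ i)"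
  shows "(\<integral>z. ((x + z) ^ m - x ^ m - real m * x ^ (m - 1) * z) \<partial>ell x) =
    (\<Sum>r\<le>m. (\<Sum>k = max 2 r..m. real (m choose k) * \<xi> k (k - r)) * x ^ (m - r))"
proof -
  have int: "integrable (ell x) (\<lambda>z. z ^ k)" if "2 \<le> k" for k
    using assms(1) that by (intro integrable_power) (auto simp: jump_diffusion_def transition_kernel_def)
  have moment: "(\<integral>z. z ^ k \<partial>ell x) = (\<Sum>r\<le>k. \<xi> k (k - r) * x ^ (k - r))" if "2 \<le> k" for k
    unfolding moments[OF that] using sum.atLeastAtMost_rev[of "\<lambda>i. \<xi> k i * x ^ i" 0 k]
    by (simp add: atMost_atLeast0)
  have "(\<integral>z. ((x + z) ^ m - x ^ m - real m * x ^ (m - 1) * z) \<partial>ell x) =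
    (\<Sum>k = 2..m. real (m choose k) * x ^ (m - k) * (\<integral>z. z ^ k \<partial>ell x))"
    unfolding binomial_remainder using int by (subst Bochner_Integration.integral_sum) auto
  also have "\<dots> = (\<Sum>k = 2..m. \<Sum>r | r \<le> m \<and> r \<le> k. real (m choose k) * \<xi> k (k - r) * x ^ (m - r))"
  proof (rule sum.cong)
    fix k
    assume k: "k \<in> {2..m}"
    have "real (m choose k) * x ^ (m - k) * (\<integral>z. z ^ k \<partial>ell x) =
      (\<Sum>r\<le>k. real (m choose k) * \<xi> k (k - r) * (x ^ (m - k) * x ^ (k - r)))"
      using k by (simp add: moment sum_distrib_left mult_ac)
    also have "\<dots> = (\<Sum>r\<le>k. real (m choose k) * \<xi> k (k - r) * x ^ (m - r))"
      using k by (simp flip: power_add)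
    \<comment> \<open>The redundant-looking bound \<open>r \<le> m\<close>, valid as
      \<open>k \<le> m\<close>, brings the double sum into the shape of
      \<open>sum.swap_restrict\<close>.\<close>
    also have "{..k} = {r. r \<le> m \<and> r \<le> k}"
      using k by auto
    finally show "real (m choose k) * x ^ (m - k) * (\<integral>z. z ^ k \<partial>ell x) =
      (\<Sum>r | r \<le> m \<and> r \<le> k. real (m choose k) * \<xi> k (k - r) * x ^ (m - r))" .
  qed simp
  also have "\<dots> = (\<Sum>r\<le>m. \<Sum>k | k \<in> {2..m} \<and> r \<le> k. real (m choose k) * \<xi> k (k - r) * x ^ (m - r))"
    using sum.swap_restrict[of "{2..m}" "{..m}" "\<lambda>k r. real (m choose k) * \<xi> k (k - r) * x ^ (m - r)" "\<lambda>k r. r \<le> k"]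
    by simp
  also have "\<dots> = (\<Sum>r\<le>m. \<Sum>k = max 2 r..m. real (m choose k) * \<xi> k (k - r) * x ^ (m - r))"
    by (intro sum.cong) auto
  finally show ?thesis
    by (simp add: sum_distrib_right)
qed

lemma jd_operator_monomial:
  assumes "jump_diffusion b \<sigma> ell"
    and b: "\<And>x. b x = b0 + b1 * x"
    and \<sigma>: "\<And>x. (\<sigma> x)\<^sup>2 = \<sigma>0 + \<sigma>1 * x + \<sigma>2 * x\<^sup>2"
    and moments: "\<And>m x. 2 \<le> m \<Longrightarrow> (\<integral>z. z ^ m \<partial>ell x) = (\<Sum>i=0..m. \<xi> m i * x ^ i)"
  shows "jd_operator b \<sigma> ell (\<lambda>y. y ^ m) x = (\<Sum>j\<le>m. gen_entry b0 b1 \<sigma>0 \<sigma>1 \<sigma>2 \<xi> m j * x ^ j)"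
proof -
  let ?J = "\<lambda>r. \<Sum>k = max 2 r..m. real (m choose k) * \<xi> k (k - r)"
  let ?u = "real m * b1 + 1 / 2 * real m * (real m - 1) * \<sigma>2"
  let ?v = "real m * b0 + 1 / 2 * real m * (real m - 1) * \<sigma>1"
  let ?w = "1 / 2 * real m * (real m - 1) * \<sigma>0"
  have "(\<Sum>j\<le>m. gen_entry b0 b1 \<sigma>0 \<sigma>1 \<sigma>2 \<xi> m j * x ^ j) =
    (\<Sum>r\<le>m. gen_entry b0 b1 \<sigma>0 \<sigma>1 \<sigma>2 \<xi> m (m - r) * x ^ (m - r))"
    using sum.atLeastAtMost_rev[of "\<lambda>j. gen_entry b0 b1 \<sigma>0 \<sigma>1 \<sigma>2 \<xi> m j * x ^ j" 0 m]
    by (simp add: atMost_atLeast0)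
  also have "\<dots> = (\<Sum>r\<le>m. (if r = 0 then ?u * x ^ m else 0) + (if r = 1 then ?v * x ^ (m - 1) else 0)
      + (if r = 2 then ?w * x ^ (m - 2) else 0) + ?J r * x ^ (m - r))"
    by (intro sum.cong) (auto simp: gen_entry_decomp algebra_simps)
  \<comment> \<open>Each conditional selects a single \<open>r\<close>; the guards record whether
    that \<open>r\<close> lies in the range.\<close>
  also have "\<dots> = ?u * x ^ m + (if 1 \<le> m then ?v * x ^ (m - 1) else 0)
      + (if 2 \<le> m then ?w * x ^ (m - 2) else 0) + (\<Sum>r\<le>m. ?J r * x ^ (m - r))"
    by (simp add: sum.distrib)
  also have "?u * x ^ m + (if 1 \<le> m then ?v * x ^ (m - 1) else 0)
      + (if 2 \<le> m then ?w * x ^ (m - 2) else 0) =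
    b x * (real m * x ^ (m - 1)) + 1 / 2 * (\<sigma> x)\<^sup>2 * (real m * (real m - 1) * x ^ (m - 2))"
  proof -
    \<comment> \<open>With \<open>X\<close> for x^(m-2) the comparison of drift and diffusion terms
      is a polynomial identity. It applies for \<open>2 \<le> m\<close>; smaller \<open>m\<close>
      are separate because there the exponent \<open>m - 2\<close> is truncated.\<close>
    have "(M * b1 + 1 / 2 * M * (M - 1) * \<sigma>2) * (x * x * X)
        + (M * b0 + 1 / 2 * M * (M - 1) * \<sigma>1) * (x * X) + 1 / 2 * M * (M - 1) * \<sigma>0 * X =
      (b0 + b1 * x) * (M * (x * X)) + 1 / 2 * (\<sigma>0 + \<sigma>1 * x + \<sigma>2 * x\<^sup>2) * (M * (M - 1) * X)"
      for M X :: real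
      by (simp add: field_simps power2_eq_square)
    note ring = this[of "real m" "x ^ (m - 2)"]
    consider "m = 0" | "m = 1" | "2 \<le> m"
      by linarith
    then show ?thesis
    proof cases
      case 3
      then obtain l where "m = Suc (Suc l)"
        by (metis Suc_le_D numeral_2_eq_2 Suc_le_mono)
      then have "x ^ m = x * x * x ^ (m - 2)" "x ^ (m - 1) = x * x ^ (m - 2)"
        by (simp_all add: mult.assoc)
      with 3 ring show ?thesis
        unfolding b \<sigma> by simp
    qed (simp_all add: b)
  qed
  finally show ?thesis
    unfolding jd_operator_def deriv_deriv_monomial
    by (simp add: deriv_monomial jump_part_monomial[OF assms(1) moments] del: One_nat_def)
qed

section \<open>Identification of the generator matrix\<close>

lemma mult_monomial_vec_nth:
  assumes "A \<in> carrier_mat (n + 1) (n + 1)" and "i \<le> n"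
  shows "vec_index (A *\<^sub>v monomial_vec n x) i = (\<Sum>j\<le>n. A $$ (i, j) * x ^ j)"
  using assms
  by (simp add: monomial_vec_def scalar_prod_def atLeast0LessThan lessThan_Suc_atMost)

text \<open>The \<open>THE\<close> requires existence, from the action on monomials, and uniqueness,
  as a polynomial function determines its coefficients.\<close>

lemma generator_matrix_eq:
  assumes "jump_diffusion b \<sigma> ell"
    and "\<And>x. b x = b0 + b1 * x"
    and "\<And>x. (\<sigma> x)\<^sup>2 = \<sigma>0 + \<sigma>1 * x + \<sigma>2 * x\<^sup>2"
    and "\<And>m x. 2 \<le> m \<Longrightarrow> (\<integral>z. z ^ m \<partial>ell x) = (\<Sum>i=0..m. \<xi> m i * x ^ i)"
  shows "generator_matrix (jd_operator b \<sigma> ell) n = gen_mat b0 b1 \<sigma>0 \<sigma>1 \<sigma>2 \<xi> n"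
proof -
  let ?e = "gen_entry b0 b1 \<sigma>0 \<sigma>1 \<sigma>2 \<xi>"
  let ?lhs = "\<lambda>x. vec (n + 1)
    (\<lambda>i. jd_operator b \<sigma> ell (\<lambda>y. vec_index (monomial_vec n y) i) x)"
  have lhs: "vec_index (?lhs x) i = (\<Sum>j\<le>n. ?e i j * x ^ j)" if "i \<le> n" for i x
  proof -
    have "vec_index (?lhs x) i = (\<Sum>j\<le>i. ?e i j * x ^ j)"
      using that by (simp add: monomial_vec_def jd_operator_monomial[OF assms])
    \<comment> \<open>Padding with the zeros above the diagonal makes all rows polynomials with the
      same index range.\<close>
    also have "\<dots> = (\<Sum>j\<le>n. ?e i j * x ^ j)"
      using that by (intro sum.mono_neutral_left) (auto simp: gen_entry_def)
    finally show ?thesis .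
  qed
  show ?thesis
    unfolding generator_matrix_def
  proof (rule the_equality)
    have lhs_eq: "?lhs x = gen_mat b0 b1 \<sigma>0 \<sigma>1 \<sigma>2 \<xi> n *\<^sub>v monomial_vec n x" for x
    proof (rule eq_vecI)
      fix i
      assume "i < dim_vec (gen_mat b0 b1 \<sigma>0 \<sigma>1 \<sigma>2 \<xi> n *\<^sub>v monomial_vec n x)"
      then have "i \<le> n" by (simp add: gen_mat_def)
      then show "vec_index (?lhs x) i =
          vec_index (gen_mat b0 b1 \<sigma>0 \<sigma>1 \<sigma>2 \<xi> n *\<^sub>v monomial_vec n x) i"
        unfolding lhs[OF \<open>i \<le> n\<close>] mult_monomial_vec_nth[OF gen_mat_carrier \<open>i \<le> n\<close>]
        by (simp add: gen_mat_def)
    qed (simp add: gen_mat_def)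
    then show "gen_mat b0 b1 \<sigma>0 \<sigma>1 \<sigma>2 \<xi> n \<in> carrier_mat (n + 1) (n + 1) \<and>
      (\<forall>x. ?lhs x = gen_mat b0 b1 \<sigma>0 \<sigma>1 \<sigma>2 \<xi> n *\<^sub>v monomial_vec n x)"
      by (intro conjI allI gen_mat_carrier) (rule lhs_eq)
  next
    fix A :: "real mat"
    assume A: "A \<in> carrier_mat (n + 1) (n + 1) \<and> (\<forall>x. ?lhs x = A *\<^sub>v monomial_vec n x)"
    have "A $$ (i, j) = ?e i j" if "i \<le> n" "j \<le> n" for i j
    proof -
      have "\<forall>x. (\<Sum>j\<le>n. A $$ (i, j) * x ^ j) = (\<Sum>j\<le>n. ?e i j * x ^ j)"
        using A lhs[OF \<open>i \<le> n\<close>] mult_monomial_vec_nth[of A n i] \<open>i \<le> n\<close> by metis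
      then show ?thesis
        using that by (simp add: polyfun_eq_coeffs)
    qed
    with A show "A = gen_mat b0 b1 \<sigma>0 \<sigma>1 \<sigma>2 \<xi> n"
      by (intro eq_matI) (auto simp: gen_mat_def)
  qed
qed

section \<open>Block recursion of the generator matrices\<close>

lemma gen_mat_Suc:
  "gen_mat b0 b1 \<sigma>0 \<sigma>1 \<sigma>2 \<xi> (Suc m) =
    four_block_mat (gen_mat b0 b1 \<sigma>0 \<sigma>1 \<sigma>2 \<xi> m) (0\<^sub>m (Suc m) 1)
      (mat_of_row (gen_a_vec b0 \<sigma>0 \<sigma>1 \<xi> (Suc m))) (gen_c b1 \<sigma>2 \<xi> (Suc m) \<cdot>\<^sub>m 1\<^sub>m 1)"
  (is "?A = ?B")
proof (rule eq_matI)
  fix i j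
  assume "i < dim_row ?B" "j < dim_col ?B"
  then consider "i \<le> m" "j \<le> m" | "i \<le> m" "j = Suc m" | "i = Suc m" "j \<le> m" | "i = Suc m" "j = Suc m"
    by (auto simp: gen_mat_def) linarith
  then show "?A $$ (i, j) = ?B $$ (i, j)"
    by cases (simp_all add: gen_mat_def gen_entry_def gen_a_vec_def)
qed (simp_all add: gen_mat_def)

lemma gen_mat_1: "gen_mat b0 b1 \<sigma>0 \<sigma>1 \<sigma>2 \<xi> 1 = mat_of_rows_list 2 [[0, 0], [b0, b1]]"
  by (intro eq_matI)
    (auto simp: gen_mat_def gen_entry_def gen_a_def gen_c_def mat_of_rows_list_def less_Suc_eq
      numeral_2_eq_2)

text \<open>The matrix is lower triangular, so its determinant is the product of the diagonal; the
  factor at \<open>i = 0\<close> is \<open>x\<close> itself.\<close>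

lemma det_shift_gen_mat:
  "det (x \<cdot>\<^sub>m 1\<^sub>m (m + 1) - gen_mat b0 b1 \<sigma>0 \<sigma>1 \<sigma>2 \<xi> m) =
    (\<Prod>i = 0..<m + 1. x - gen_c b1 \<sigma>2 \<xi> i)"
proof -
  let ?A = "x \<cdot>\<^sub>m 1\<^sub>m (m + 1) - gen_mat b0 b1 \<sigma>0 \<sigma>1 \<sigma>2 \<xi> m"
  have "det ?A = prod_list (diag_mat ?A)"
    by (rule det_lower_triangular[of "m + 1"]) (auto simp: gen_mat_def gen_entry_def)
  also have "\<dots> = (\<Prod>i = 0..<m + 1. x - gen_c b1 \<sigma>2 \<xi> i)"
    unfolding prod_list_diag_prod by (rule prod.cong) (auto simp: gen_mat_def gen_entry_def)
  finally show ?thesis .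
qed

text \<open>The block exponential is used with \<open>t * x\<close>,
  \<open>t \<cdot>\<^sub>m B\<close> and \<open>q = a * L\<close>. Because t a = q (t x I - t B),
  the row \<open>q\<close> does not depend on \<open>t\<close>, and \<open>t = 0\<close> needs no
  separate treatment.\<close>

lemma mat_exp_gen_mat_Suc:
  fixes b0 b1 \<sigma>0 \<sigma>1 \<sigma>2 t :: real and \<xi> :: "nat \<Rightarrow> nat \<Rightarrow> real" and m :: nat
  defines "B \<equiv> gen_mat b0 b1 \<sigma>0 \<sigma>1 \<sigma>2 \<xi> m"
    and "x \<equiv> gen_c b1 \<sigma>2 \<xi> (Suc m)"
    and "a \<equiv> mat_of_row (gen_a_vec b0 \<sigma>0 \<sigma>1 \<xi> (Suc m))"
  assumes L: "L \<in> carrier_mat (Suc m) (Suc m)"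
    and inv: "L * (x \<cdot>\<^sub>m 1\<^sub>m (Suc m) - B) = 1\<^sub>m (Suc m)"
  shows "mat_exp (t \<cdot>\<^sub>m gen_mat b0 b1 \<sigma>0 \<sigma>1 \<sigma>2 \<xi> (Suc m)) =
    four_block_mat (mat_exp (t \<cdot>\<^sub>m B)) (0\<^sub>m (Suc m) 1)
      (a * L * (exp (x * t) \<cdot>\<^sub>m 1\<^sub>m (Suc m) - mat_exp (t \<cdot>\<^sub>m B))) (exp (x * t) \<cdot>\<^sub>m 1\<^sub>m 1)"
proof -
  let ?n = "Suc m"
  have B: "B \<in> carrier_mat ?n ?n"
    using gen_mat_carrier[of b0 b1 \<sigma>0 \<sigma>1 \<sigma>2 \<xi> m] by (simp add: B_def)
  have a: "a \<in> carrier_mat 1 ?n"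
    by (simp add: a_def gen_a_vec_def)
  have "(t * x) \<cdot>\<^sub>m 1\<^sub>m ?n - t \<cdot>\<^sub>m B = t \<cdot>\<^sub>m (x \<cdot>\<^sub>m 1\<^sub>m ?n - B)"
    using B by (intro eq_matI) (auto simp: algebra_simps)
  then have "a * L * ((t * x) \<cdot>\<^sub>m 1\<^sub>m ?n - t \<cdot>\<^sub>m B) = t \<cdot>\<^sub>m (a * L * (x \<cdot>\<^sub>m 1\<^sub>m ?n - B))"
    using a L B by (subst mult_smult_distrib[of _ 1 ?n _ ?n, symmetric]) auto
  also have "a * L * (x \<cdot>\<^sub>m 1\<^sub>m ?n - B) = a * (L * (x \<cdot>\<^sub>m 1\<^sub>m ?n - B))"
    using a L B by (intro assoc_mult_mat) auto
  finally have r: "t \<cdot>\<^sub>m a = a * L * ((t * x) \<cdot>\<^sub>m 1\<^sub>m ?n - t \<cdot>\<^sub>m B)"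
    using a by (simp add: inv)
  have "t \<cdot>\<^sub>m gen_mat b0 b1 \<sigma>0 \<sigma>1 \<sigma>2 \<xi> ?n =
    four_block_mat (t \<cdot>\<^sub>m B) (0\<^sub>m ?n 1) (t \<cdot>\<^sub>m a) ((t * x) \<cdot>\<^sub>m 1\<^sub>m 1)"
    unfolding gen_mat_Suc B_def[symmetric] a_def[symmetric] x_def[symmetric]
    using a B by (intro eq_matI) auto
  also have "mat_exp \<dots> = four_block_mat (mat_exp (t \<cdot>\<^sub>m B)) (0\<^sub>m ?n 1)
      (a * L * (exp (t * x) \<cdot>\<^sub>m 1\<^sub>m ?n - mat_exp (t \<cdot>\<^sub>m B))) (exp (t * x) \<cdot>\<^sub>m 1\<^sub>m 1)"
    by (rule mat_exp_four_block_lower[OF _ _ r]) (use a L B in auto)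
  finally show ?thesis
    by (simp add: mult.commute)
qed

section \<open>The exponential formula for polynomial jump-diffusions\<close>

theorem theorem5p3:
  fixes b \<sigma> :: "real \<Rightarrow> real" and ell :: "real \<Rightarrow> real measure"
    and b0 b1 \<sigma>0 \<sigma>1 \<sigma>2 :: real and \<xi> :: "nat \<Rightarrow> nat \<Rightarrow> real"
    and G :: "nat \<Rightarrow> real mat" and c :: "nat \<Rightarrow> real" and a :: "nat \<Rightarrow> real vec"
    and \<Lambda> :: "real mat" and n :: nat and t :: real
  defines "G \<equiv> generator_matrix (jd_operator b \<sigma> ell)"
    and "c \<equiv> gen_c b1 \<sigma>2 \<xi>"
    and "a \<equiv> gen_a_vec b0 \<sigma>0 \<sigma>1 \<xi>"
    and "\<Lambda> \<equiv> c n \<cdot>\<^sub>m 1\<^sub>m n - G (n - 1)"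
  assumes "jump_diffusion b \<sigma> ell"
    and "\<And>x. b x = b0 + b1 * x"
    and "\<And>x. (\<sigma> x)\<^sup>2 = \<sigma>0 + \<sigma>1 * x + \<sigma>2 * x\<^sup>2"
    and "\<And>m x. 2 \<le> m \<Longrightarrow> (\<integral>z. z ^ m \<partial>ell x) = (\<Sum>i=0..m. \<xi> m i * x ^ i)"
    and "2 \<le> n"
    and "\<And>j. 2 \<le> j \<Longrightarrow> j \<le> n \<Longrightarrow> c j \<noteq> 0"
    and "\<And>i j. 1 \<le> j \<Longrightarrow> j < i \<Longrightarrow> i \<le> n \<Longrightarrow> c j \<noteq> c i"
    and "0 \<le> t"
  shows "invertible_mat \<Lambda> \<and>
    mat_exp (t \<cdot>\<^sub>m G n) =
      four_block_mat
        (mat_exp (t \<cdot>\<^sub>m G (n - 1)))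
        (0\<^sub>m n 1)
        (mat_of_row (a n) * mat_inv \<Lambda> *
           (exp (c n * t) \<cdot>\<^sub>m 1\<^sub>m n - mat_exp (t \<cdot>\<^sub>m G (n - 1))))
        (mat_of_rows_list 1 [[exp (c n * t)]]) \<and>
    (b1 \<noteq> 0 \<longrightarrow> mat_exp (t \<cdot>\<^sub>m G 1) =
      mat_of_rows_list 2 [[1, 0], [b0 / b1 * (exp (b1 * t) - 1), exp (b1 * t)]]) \<and>
    (b1 = 0 \<longrightarrow> mat_exp (t \<cdot>\<^sub>m G 1) =
      mat_of_rows_list 2 [[1, 0], [b0 * t, 1]])"
proof -
  have G: "G k = gen_mat b0 b1 \<sigma>0 \<sigma>1 \<sigma>2 \<xi> k" for k
    unfolding G_def by (rule generator_matrix_eq) (fact assms(5-8))+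
  obtain m where n: "n = Suc m"
    using \<open>2 \<le> n\<close> by (cases n) auto
  have \<Lambda>: "\<Lambda> \<in> carrier_mat n n"
    using gen_mat_carrier[of b0 b1 \<sigma>0 \<sigma>1 \<sigma>2 \<xi> m] by (simp add: \<Lambda>_def G n minus_carrier_mat)
  \<comment> \<open>For \<open>i = 0\<close> the difference is \<open>c n\<close>, nonzero by the
    first spectral condition; for \<open>i \<ge> 1\<close> the pairwise distinctness
    applies.\<close>
  have "c n - c i \<noteq> 0" if "i < n" for i
    using that assms(9) assms(10)[of n] assms(11)[of i n] by (cases "i = 0") (auto simp: c_def)
  then have "det \<Lambda> \<noteq> 0"
    unfolding \<Lambda>_def G n using det_shift_gen_mat[of "c n" m b0 b1 \<sigma>0 \<sigma>1 \<sigma>2 \<xi>]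
    by (simp add: n c_def)
  note inv = det_nonzero_mat_inv[OF \<Lambda> this]
  have corner: "mat_of_rows_list 1 [[y]] = y \<cdot>\<^sub>m 1\<^sub>m 1" for y :: real
    by (intro eq_matI) (auto simp: mat_of_rows_list_def)
  have "mat_inv \<Lambda> * (c (Suc m) \<cdot>\<^sub>m 1\<^sub>m (Suc m) - G m) = 1\<^sub>m (Suc m)"
    using inv(4) by (simp add: \<Lambda>_def n)
  from mat_exp_gen_mat_Suc[OF _ this[unfolded c_def G], of t] inv(2)
  have exp: "mat_exp (t \<cdot>\<^sub>m G n) = four_block_mat (mat_exp (t \<cdot>\<^sub>m G (n - 1))) (0\<^sub>m n 1)
    (mat_of_row (a n) * mat_inv \<Lambda> * (exp (c n * t) \<cdot>\<^sub>m 1\<^sub>m n - mat_exp (t \<cdot>\<^sub>m G (n - 1))))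
    (mat_of_rows_list 1 [[exp (c n * t)]])"
    by (simp add: n G corner a_def c_def del: One_nat_def)
  have G1: "t \<cdot>\<^sub>m G 1 = mat_of_rows_list 2 [[0, 0], [b0 * t, b1 * t]]"
    unfolding G gen_mat_1
    by (intro eq_matI) (auto simp: mat_of_rows_list_def less_Suc_eq numeral_2_eq_2)
  have "mat_exp (t \<cdot>\<^sub>m G 1) =
      mat_of_rows_list 2 [[1, 0], [b0 / b1 * (exp (b1 * t) - 1), exp (b1 * t)]]" if "b1 \<noteq> 0"
  \<comment> \<open>The closed form divides by b1 t. At \<open>t = 0\<close> the matrix is zero and
    counts as nilpotent; otherwise \<open>t\<close> cancels from the quotient.\<close>
  proof (cases "t = 0")
    case True
    then show ?thesis
      unfolding G1 using mat_exp_2x2_nilpotent[of 0] by simp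
  next
    case False
    then show ?thesis
      unfolding G1 using mat_exp_2x2_lower[of "b1 * t" "b0 * t"] \<open>b1 \<noteq> 0\<close> by simp
  qed
  moreover have "mat_exp (t \<cdot>\<^sub>m G 1) = mat_of_rows_list 2 [[1, 0], [b0 * t, 1]]" if "b1 = 0"
    unfolding G1 using mat_exp_2x2_nilpotent[of "b0 * t"] that by simp
  ultimately show ?thesis
    using inv(1) exp by blast
qed

end
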